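(* Let $\alpha\in(0,0.5)$. For every $N>1$, the worst-case regret of the QCARE policy with parameter $\alpha$ on $N$-armed bandit problems satisfies $$\mathcal R(T)=\Omega(T^{1-\alpha})\quad\text{as }T\to\infty .$$
   Context: Bandit problem. There are $N$ arms, $[N]=\{1,\dots,N\}$. Each arm $i$ has an i.i.d. reward sequence $\{r_i(t)\}_{t\ge1}$ drawn from a fixed distribution supported on $[0,1]$ with mean $\mu_i$; the collection of reward distributions is the instance $\Theta$. The optimal arm $i^*=\arg\max_i\mu_i$ is assumed unique, and $\mu^*=\max_i\mu_i$. At each time $t=1,2,\dots$ an action $a(t)\in[N]$ is chosen and the reward $r_{a(t)}(t)$ is observed; conditionally on the past and on $a(t)=i$, this reward has arm $i$'s distribution. The regret on instance $\Theta$ is $\mathcal R^\Theta(T)=\mu^*T-\mathbb E\big[\sum_{t=1}^T r_{a(t)}(t)\big]$ and the worst-case regret is $\mathcal R(T)=\sup_\Theta\mathcal R^\Theta(T)$, the supremum being over all $N$-armed instances, separately for each $T$. QCARE. Let $k_i(t)=\sum_{\ell=1}^{t-1}\mathbb I\{a(\ell)=i\}$ and $\hat\mu_i(t)=\frac{1}{k_i(t)+1}\sum_{\ell\le t-1:\,a(\ell)=i} r_i(\ell)$. The QCARE policy with parameter $\alpha$ plays at each time $t$ the arm $a(t)=\arg\max_i\theta_i(t)$, where $\theta_i(t)=\hat\mu_i(t)+\frac{\epsilon_{it}}{(k_i(t)+1)^\alpha}$ and the $\epsilon_{it}$ are independent standard normal random variables (independent of the rewards). Notation: $f(T)=\Omega(g(T))$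 means $\liminf_{T\to\infty}f(T)/g(T)>0$. *)

theory Defs
  imports "HOL-Probability.Probability"
begin

section \<open>Bandit instances\<close>

text \<open>
  Arms are the numbers \<open>1, \<dots>, N\<close> and times the numbers \<open>1, 2, \<dots>\<close>. An instance assigns a
  distribution to every arm; its values outside \<open>{1..N}\<close> are irrelevant.
\<close>

definition arm_mean :: "(nat \<Rightarrow> real measure) \<Rightarrow> nat \<Rightarrow> real" where
  "arm_mean \<Theta> i = (\<integral>x. x \<partial>\<Theta> i)"

definition bandit_instances :: "nat \<Rightarrow> (nat \<Rightarrow> real measure) set" where
  "bandit_instances N = {\<Theta>.
     (\<forall>i\<in>{1..N}. prob_space (\<Theta> i) \<and> sets (\<Theta> i) = sets borel \<and> emeasure (\<Theta> i) {0..1} = 1) \<and>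
     (\<exists>!i. i \<in> {1..N} \<and> (\<forall>j\<in>{1..N}. arm_mean \<Theta> j \<le> arm_mean \<Theta> i))}"

definition optimal_mean :: "nat \<Rightarrow> (nat \<Rightarrow> real measure) \<Rightarrow> real" where
  "optimal_mean N \<Theta> = (MAX i\<in>{1..N}. arm_mean \<Theta> i)"

section \<open>The QCARE policy\<close>

text \<open>
  Here \<open>a\<close> is an action sequence, \<open>r (i, t)\<close> is the reward of arm \<open>i\<close> at time \<open>t\<close>, and
  \<open>e (i, t)\<close> is the exploration noise of arm \<open>i\<close> at time \<open>t\<close>.
\<close>

definition pull_count :: "(nat \<Rightarrow> nat) \<Rightarrow> nat \<Rightarrow> nat \<Rightarrow> nat" where
  "pull_count a t i = (\<Sum>l\<in>{1..<t}. if a l = i then 1 else 0)"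

definition mean_estimate :: "(nat \<times> nat \<Rightarrow> real) \<Rightarrow> (nat \<Rightarrow> nat) \<Rightarrow> nat \<Rightarrow> nat \<Rightarrow> real" where
  "mean_estimate r a t i =
     (\<Sum>l | l \<in> {1..<t} \<and> a l = i. r (i, l)) / (real (pull_count a t i) + 1)"

definition qcare_index ::
  "real \<Rightarrow> (nat \<times> nat \<Rightarrow> real) \<Rightarrow> (nat \<times> nat \<Rightarrow> real) \<Rightarrow> (nat \<Rightarrow> nat) \<Rightarrow> nat \<Rightarrow> nat \<Rightarrow> real" where
  "qcare_index \<alpha> r e a t i =
     mean_estimate r a t i + e (i, t) / (real (pull_count a t i) + 1) powr \<alpha>"

text \<open>
  The index at time \<open>t\<close> only depends on the actions taken before \<open>t\<close>; this congruence rule makes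
  the recursive definition of the actions well-founded.
\<close>

lemma qcare_index_cong [fundef_cong]:
  assumes "\<alpha> = \<alpha>'" "r = r'" "e = e'" "t = t'" "\<And>l. l \<in> {1..<t'} \<Longrightarrow> a l = a' l"
  shows "qcare_index \<alpha> r e a t = qcare_index \<alpha>' r' e' a' t'"
proof
  fix i
  have "pull_count a t' i = pull_count a' t' i"
    unfolding pull_count_def using assms(5) by (intro sum.cong) auto
  moreover have "{l. l \<in> {1..<t'} \<and> a l = i} = {l. l \<in> {1..<t'} \<and> a' l = i}"
    using assms(5) by auto
  ultimately show "qcare_index \<alpha> r e a t i = qcare_index \<alpha>' r' e' a' t' i"
    using assms(1-4) by (simp add: qcare_index_def mean_estimate_def)
qed

text \<open>
  Ties in the maximum, which have probability zero at every time, are broken by the fixed choice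
  made by \<^const>\<open>arg_max_on\<close>.
\<close>

fun qcare_action ::
  "real \<Rightarrow> nat \<Rightarrow> (nat \<times> nat \<Rightarrow> real) \<Rightarrow> (nat \<times> nat \<Rightarrow> real) \<Rightarrow> nat \<Rightarrow> nat" where
  "qcare_action \<alpha> N r e t =
     arg_max_on (\<lambda>i. qcare_index \<alpha> r e (\<lambda>l. qcare_action \<alpha> N r e l) t i) {1..N}"

declare qcare_action.simps [simp del]

section \<open>Regret\<close>

text \<open>
  A sample point is a pair of a reward table and a noise table, all of whose entries are
  independent.
\<close>

definition bandit_space ::
  "nat \<Rightarrow> (nat \<Rightarrow> real measure) \<Rightarrow> ((nat \<times> nat \<Rightarrow> real) \<times> (nat \<times> nat \<Rightarrow> real)) measure" where
  "bandit_space N \<Theta> =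
     (\<Pi>\<^sub>M (i, t)\<in>{1..N} \<times> {1..}. \<Theta> i) \<Otimes>\<^sub>M
     (\<Pi>\<^sub>M (i, t)\<in>{1..N} \<times> {1..}. density lborel (\<lambda>x. ennreal (std_normal_density x)))"

definition qcare_regret :: "real \<Rightarrow> nat \<Rightarrow> (nat \<Rightarrow> real measure) \<Rightarrow> nat \<Rightarrow> real" where
  "qcare_regret \<alpha> N \<Theta> T =
     optimal_mean N \<Theta> * real T -
     (\<integral>(r, e). (\<Sum>t\<in>{1..T}. r (qcare_action \<alpha> N r e t, t)) \<partial>bandit_space N \<Theta>)"

text \<open>The supremum is taken in the extended reals, so that it needs no boundedness condition.\<close>

definition qcare_worst_case_regret :: "real \<Rightarrow> nat \<Rightarrow> nat \<Rightarrow> ereal" where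
  "qcare_worst_case_regret \<alpha> N T = (SUP \<Theta>\<in>bandit_instances N. ereal (qcare_regret \<alpha> N \<Theta> T))"

end

theory Submission imports Defs begin

text \<open>
  For the horizon \<open>T\<close> take the deterministic instance whose first arm pays \<open>\<Delta> = T\<^bsup>-\<alpha>\<^esup>\<close> and whose
  other arms pay \<open>0\<close>. Up to time \<open>T\<close> every noise scale is at least \<open>T\<^bsup>-\<alpha>\<^esup> = \<Delta>\<close>, so whenever
  \<open>\<epsilon>\<^sub>1\<^sub>t \<le> -1\<close> and \<open>\<epsilon>\<^sub>2\<^sub>t > 0\<close> the index of arm 1 is at most \<open>\<Delta> - \<Delta> = 0\<close>, that of arm 2 is positive,
  and arm 1 is not played. This event has a probability \<open>c > 0\<close> that depends neither on \<open>t\<close> nor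
  on \<open>T\<close>, so the regret is at least \<open>c \<Delta> T = c T\<^bsup>1-\<alpha>\<^esup>\<close>.
\<close>

section \<open>Pathwise behaviour of the policy\<close>

text \<open>A finite nonempty set attains its maximum, so the choice behind
  \<open>arg_max_on\<close> meets its specification. Later steps use only this specification, so
  they hold however ties are broken.\<close>

lemma is_arg_max_arg_max_on:
  fixes f :: "'a \<Rightarrow> 'b :: linorder"
  assumes "finite S" "S \<noteq> {}"
  shows "is_arg_max f (\<lambda>x. x \<in> S) (arg_max_on f S)"
proof -
  have "Max (f ` S) \<in> f ` S"
    using assms by (intro Max_in) auto
  then obtain x where "x \<in> S" "f x = Max (f ` S)"
    by auto
  then have "is_arg_max f (\<lambda>x. x \<in> S) x"
    using assms by (auto simp: is_arg_max_linorder)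
  then show ?thesis
    unfolding arg_max_on_def arg_max_def by (rule someI)
qed

lemma is_arg_max_qcare_action:
  assumes "N \<ge> 1"
  shows "is_arg_max (qcare_index \<alpha> r e (qcare_action \<alpha> N r e) t) (\<lambda>i. i \<in> {1..N})
    (qcare_action \<alpha> N r e t)"
  using assms is_arg_max_arg_max_on[of "{1..N}" "qcare_index \<alpha> r e (qcare_action \<alpha> N r e) t"]
  by (simp add: qcare_action.simps[of \<alpha> N r e t])

lemma pull_count_eq_card: "pull_count a t i = card {l. l \<in> {1..<t} \<and> a l = i}"
  unfolding pull_count_def by (simp add: sum.If_cases Int_def)

text \<open>Only times strictly before \<open>t\<close> are counted. Hence the count plus one is at
  most \<open>t\<close>, which keeps the noise scale from falling below
  \<open>T powr - \<alpha>\<close> up to the horizon.\<close>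

lemma pull_count_less:
  assumes "t \<ge> 1"
  shows "pull_count a t i < t"
proof -
  have "pull_count a t i \<le> card {1..<t}"
    unfolding pull_count_eq_card by (intro card_mono) auto
  then show ?thesis
    using assms by simp
qed

lemma mean_estimate_constant:
  assumes "\<And>l. l \<ge> 1 \<Longrightarrow> r (i, l) = m"
  shows "mean_estimate r a t i = m * (real (pull_count a t i) / (real (pull_count a t i) + 1))"
proof -
  have "(\<Sum>l | l \<in> {1..<t} \<and> a l = i. r (i, l)) = (\<Sum>l | l \<in> {1..<t} \<and> a l = i. m)"
    using assms by (intro sum.cong) auto
  then show ?thesis
    by (simp add: mean_estimate_def pull_count_eq_card)
qed

text \<open>The comparison of indices on a single sample path, free of probability: the estimate of
  arm 2 is exactly 0, and that of arm 1 never exceeds its true mean.\<close>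

lemma qcare_action_neq_1:
  assumes "\<alpha> \<ge> 0" "N \<ge> 2" "1 \<le> t" "t \<le> T"
    and r1: "\<And>l. l \<ge> 1 \<Longrightarrow> r (1, l) = real T powr - \<alpha>"
    and r2: "\<And>l. l \<ge> 1 \<Longrightarrow> r (2, l) = 0"
    and e: "e (1, t) \<le> -1" "e (2, t) > 0"
  shows "qcare_action \<alpha> N r e t \<noteq> 1"
proof
  let ?a = "qcare_action \<alpha> N r e"
  let ?k = "real (pull_count ?a t 1)"
  assume "?a t = 1"
  then have le: "qcare_index \<alpha> r e ?a t 2 \<le> qcare_index \<alpha> r e ?a t 1"
    using is_arg_max_qcare_action[of N \<alpha> r e t] assms(2) by (simp add: is_arg_max_linorder)
  have "qcare_index \<alpha> r e ?a t 2 > 0"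
    using mean_estimate_constant[of r 2 0, OF r2] e(2) by (simp add: qcare_index_def)
  moreover have "qcare_index \<alpha> r e ?a t 1 \<le> 0"
  proof -
    have k: "?k + 1 \<le> real T"
      using pull_count_less[of t ?a 1] assms(3,4) by linarith
    have "mean_estimate r ?a t 1 = real T powr - \<alpha> * (?k / (?k + 1))"
      using r1 by (rule mean_estimate_constant)
    also have "\<dots> \<le> real T powr - \<alpha> * 1"
      by (intro mult_left_mono) auto
    \<comment> \<open>The gap is at most the current noise scale of arm 1, so one negative unit of
      noise cancels it.\<close>
    also have "\<dots> \<le> (?k + 1) powr - \<alpha>"
      using k assms(1) by (simp add: powr_mono2')
    finally have "mean_estimate r ?a t 1 \<le> 1 / (?k + 1) powr \<alpha>"
      by (simp add: powr_minus_divide)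
    moreover have "e (1, t) / (?k + 1) powr \<alpha> \<le> - 1 / (?k + 1) powr \<alpha>"
      using e(1) by (intro divide_right_mono) auto
    ultimately show ?thesis
      by (simp add: qcare_index_def)
  qed
  ultimately show False
    using le by simp
qed

section \<open>Gaussian intervals and the hard instance\<close>

definition std_normal :: "real measure" where
  "std_normal = density lborel (\<lambda>x. ennreal (std_normal_density x))"

lemma prob_space_std_normal: "prob_space std_normal"
  unfolding std_normal_def by (rule prob_space_normal_density) simp

lemma sets_std_normal [simp]: "sets std_normal = sets borel"
  by (simp add: std_normal_def)

text \<open>The normal density is strictly positive, so a null set of the normal law is Lebesgue
  null, whereas the interval has positive length.\<close>

lemma measure_std_normal_Icc_pos:
  assumes "a < b"
  shows "measure std_normal {a..b} > 0"
proof -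
  interpret prob_space std_normal
    by (rule prob_space_std_normal)
  have "measure std_normal {a..b} \<noteq> 0"
  proof
    assume "measure std_normal {a..b} = 0"
    then have "{a..b} \<in> null_sets std_normal"
      by (intro null_setsI) (auto simp: emeasure_eq_measure)
    moreover have "\<not> std_normal_density x \<le> 0" for x :: real
      using normal_density_pos[of 1 0 x] by (simp add: not_le)
    ultimately have "AE x in lborel. x \<notin> {a..b}"
      unfolding std_normal_def
      by (subst (asm) null_sets_density_iff) (auto simp: ennreal_eq_0_iff)
    then have "emeasure lborel {a..b} = 0"
      by (subst (asm) AE_iff_measurable[where N = "{a..b}"]) auto
    then show False
      using assms by simp
  qed
  then show ?thesis
    by (simp add: zero_less_measure_iff)
qed

text \<open>Point masses leave the exploration noise as the only randomness.\<close>

definition spike_instance :: "real \<Rightarrow> nat \<Rightarrow> real measure" where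
  "spike_instance \<Delta> i = return borel (if i = 1 then \<Delta> else 0)"

lemma arm_mean_spike_instance: "arm_mean (spike_instance \<Delta>) i = (if i = 1 then \<Delta> else 0)"
  unfolding arm_mean_def spike_instance_def by (subst integral_return) auto

lemma prob_space_spike_instance: "prob_space (spike_instance \<Delta> i)"
  unfolding spike_instance_def by (rule prob_space_return) simp

lemma spike_instance_in_bandit_instances:
  assumes "0 < \<Delta>" "\<Delta> \<le> 1" "N \<ge> 1"
  shows "spike_instance \<Delta> \<in> bandit_instances N"
proof -
  have "\<exists>!i. i \<in> {1..N} \<and> (\<forall>j\<in>{1..N}. arm_mean (spike_instance \<Delta>) j \<le> arm_mean (spike_instance \<Delta>) i)"
    using assms by (intro ex1I[of _ 1]) (auto simp: arm_mean_spike_instance split: if_splits)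
  moreover have "sets (spike_instance \<Delta> i) = sets borel" "emeasure (spike_instance \<Delta> i) {0..1} = 1" for i
    using assms by (auto simp: spike_instance_def)
  ultimately show ?thesis
    by (simp add: bandit_instances_def prob_space_spike_instance)
qed

lemma optimal_mean_spike_instance:
  assumes "0 \<le> \<Delta>" "N \<ge> 1"
  shows "optimal_mean N (spike_instance \<Delta>) = \<Delta>"
  unfolding optimal_mean_def
  using assms by (intro Max_eqI) (auto simp: arm_mean_spike_instance intro!: image_eqI[of _ _ 1])

section \<open>Reward and noise product spaces\<close>

definition reward_space where
  "reward_space N \<Theta> = (\<Pi>\<^sub>M (i, t)\<in>{1..N} \<times> {1::nat..}. (\<Theta> (i::nat) :: real measure))"

definition noise_space :: "nat \<Rightarrow> (nat \<times> nat \<Rightarrow> real) measure" where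
  "noise_space N = (\<Pi>\<^sub>M (i, t)\<in>{1..N} \<times> {1..}. std_normal)"

lemma bandit_space_eq: "bandit_space N \<Theta> = reward_space N \<Theta> \<Otimes>\<^sub>M noise_space N"
  by (simp add: bandit_space_def reward_space_def noise_space_def std_normal_def)

lemma prob_space_noise_space: "prob_space (noise_space N)"
  unfolding noise_space_def by (intro prob_space_PiM) (auto simp: prob_space_std_normal)

lemma prob_space_reward_space:
  assumes "\<And>i. i \<in> {1..N} \<Longrightarrow> prob_space (\<Theta> i)"
  shows "prob_space (reward_space N \<Theta>)"
  unfolding reward_space_def using assms by (intro prob_space_PiM) auto

text \<open>Each coordinate is almost surely constant, and there are only countably many
  coordinates.\<close>

lemma AE_reward_space_spike:
  "AE r in reward_space N (spike_instance \<Delta>).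
     \<forall>(i, t)\<in>{1..N} \<times> {1..}. r (i, t) = (if i = 1 then \<Delta> else 0)"
proof -
  have "AE r in reward_space N (spike_instance \<Delta>). r p = (if fst p = 1 then \<Delta> else 0)"
    if p: "p \<in> {1..N} \<times> {1..}" for p
    unfolding reward_space_def
  proof (rule AE_PiM_component[OF _ p])
    show "AE x in case p of (i, t) \<Rightarrow> spike_instance \<Delta> i. x = (if fst p = 1 then \<Delta> else 0)"
      by (cases p) (simp only: spike_instance_def case_prod_conv fst_conv, subst AE_return, auto)
  qed (auto simp: prob_space_spike_instance)
  then have "AE r in reward_space N (spike_instance \<Delta>).
      \<forall>p\<in>{1..N} \<times> {1..}. r p = (if fst p = 1 then \<Delta> else 0)"
    by (subst AE_ball_countable) auto
  then show ?thesis
    by (rule AE_mp) auto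
qed

text \<open>A subevent of the one in \<open>qcare_action_neq_1\<close>, cut down to compact
  intervals so that \<open>measure_std_normal_Icc_pos\<close> bounds its probability away from
  0.\<close>

definition bad_noise :: "nat \<Rightarrow> nat \<Rightarrow> (nat \<times> nat \<Rightarrow> real) set" where
  "bad_noise N t = {e \<in> space (noise_space N). e (1, t) \<in> {-2..-1} \<and> e (2, t) \<in> {1..2}}"

text \<open>The event constrains two distinct coordinates of a product measure, so its probability
  factors and is the same for all \<open>t\<close>.\<close>

lemma
  assumes "N \<ge> 2" "t \<ge> 1"
  shows sets_bad_noise: "bad_noise N t \<in> sets (noise_space N)"
    and measure_bad_noise:
      "measure (noise_space N) (bad_noise N t) = measure std_normal {-2..-1} * measure std_normal {1..2}"
proof -
  interpret S: prob_space std_normal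
    by (rule prob_space_std_normal)
  interpret prob_space "noise_space N"
    by (rule prob_space_noise_space)
  interpret P: product_prob_space "\<lambda>(i, t). std_normal" "{1..N} \<times> {1::nat..}"
    by (rule product_prob_spaceI) (auto simp: prob_space_std_normal)
  let ?J = "{(1, t), (2, t)}"
  let ?X = "\<lambda>(i, _ :: nat). if i = (1 :: nat) then {-2..-1} else {1..2 :: real}"
  have J: "?J \<subseteq> {1..N} \<times> {1..}"
    using assms by auto
  have eq: "bad_noise N t = {e \<in> space (noise_space N). \<forall>p\<in>?J. e p \<in> ?X p}"
    by (auto simp: bad_noise_def)
  have comp: "(\<lambda>e. e p) \<in> borel_measurable (noise_space N)" if "p \<in> ?J" for p
  proof -
    have "(\<lambda>e. e p) \<in> measurable (noise_space N) (case p of (i, t) \<Rightarrow> std_normal)"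
      unfolding noise_space_def using J that by (intro measurable_component_singleton) auto
    then show ?thesis
      by (simp add: measurable_cong_sets[OF refl sets_std_normal] split: prod.splits)
  qed
  have [measurable]: "(\<lambda>e. e (1, t)) \<in> borel_measurable (noise_space N)"
      "(\<lambda>e. e (2, t)) \<in> borel_measurable (noise_space N)"
    by (auto intro: comp)
  show "bad_noise N t \<in> sets (noise_space N)"
    unfolding bad_noise_def by measurable
  have "emeasure (noise_space N) (bad_noise N t) = (\<Prod>p\<in>?J. emeasure (case p of (i, t) \<Rightarrow> std_normal) (?X p))"
    unfolding eq noise_space_def using J by (intro P.emeasure_PiM_Collect) auto
  then show "measure (noise_space N) (bad_noise N t) = measure std_normal {-2..-1} * measure std_normal {1..2}"
    by (simp add: S.emeasure_eq_measure emeasure_eq_measure flip: ennreal_mult)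
qed

section \<open>Regret lower bound\<close>

lemma qcare_regret_spike_ge:
  fixes \<alpha> :: real and N T :: nat
  assumes "\<alpha> \<ge> 0" "N \<ge> 2" "T \<ge> 1"
  shows "qcare_regret \<alpha> N (spike_instance (real T powr - \<alpha>)) T \<ge>
    measure std_normal {-2..-1} * measure std_normal {1..2} * real T powr (1 - \<alpha>)"
proof -
  define \<Delta> where "\<Delta> = real T powr - \<alpha>"
  define c where "c = measure std_normal {-2..-1} * measure std_normal {1..2}"
  define R where "R = reward_space N (spike_instance \<Delta>)"
  define E where "E = noise_space N"
  interpret R: prob_space R
    unfolding R_def by (intro prob_space_reward_space prob_space_spike_instance)
  interpret E: prob_space E
    unfolding E_def by (rule prob_space_noise_space)
  interpret RE: pair_prob_space R E ..
  have "\<Delta> > 0"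
    using assms by (simp add: \<Delta>_def)
  have sets_bad [measurable]: "bad_noise N t \<in> sets E" if "t \<in> {1..T}" for t
    unfolding E_def using sets_bad_noise assms that by simp
  \<comment> \<open>An upper bound on the collected reward that depends on the noise alone: at most
    \<open>\<Delta>\<close> per round, and nothing in rounds with bad noise.\<close>
  define h where "h e = (\<Sum>t\<in>{1..T}. \<Delta> * (1 - indicator (bad_noise N t) e))" for e
  have int_h: "integrable E h"
    unfolding h_def using sets_bad
    by (intro Bochner_Integration.integrable_sum integrable_mult_right Bochner_Integration.integrable_diff)
       (auto simp: E.emeasure_eq_measure)
  have "(\<integral>e. h e \<partial>E) = (\<Sum>t\<in>{1..T}. \<Delta> * (1 - measure E (bad_noise N t)))"
    unfolding h_def using sets_bad
    by (subst Bochner_Integration.integral_sum)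
       (auto simp: E.emeasure_eq_measure E.prob_space intro!: sum.cong)
  also have "\<dots> = (\<Sum>t\<in>{1..T}. \<Delta> * (1 - c))"
    using assms by (intro sum.cong) (auto simp: E_def c_def measure_bad_noise)
  finally have h: "(\<integral>e. h e \<partial>E) = real T * (\<Delta> * (1 - c))"
    by simp
  \<comment> \<open>As \<open>R\<close> has total mass 1, the noise marginal is \<open>E\<close>;
    this carries the integral of \<open>h\<close> over to the product.\<close>
  have distr_snd: "distr (R \<Otimes>\<^sub>M E) E snd = E"
  proof (rule measure_eqI)
    fix A assume A: "A \<in> sets (distr (R \<Otimes>\<^sub>M E) E snd)"
    then have "snd -` A \<inter> space (R \<Otimes>\<^sub>M E) = space R \<times> A"
      using sets.sets_into_space[of A E] by (auto simp: space_pair_measure)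
    then show "emeasure (distr (R \<Otimes>\<^sub>M E) E snd) A = emeasure E A"
      using A by (simp add: emeasure_distr E.emeasure_pair_measure_Times R.emeasure_space_1)
  qed simp
  have int_h': "integrable (R \<Otimes>\<^sub>M E) (\<lambda>x. h (snd x))"
    using int_h by (intro integrable_distr[of snd _ E]) (auto simp: distr_snd)
  have "(\<integral>x. h (snd x) \<partial>(R \<Otimes>\<^sub>M E)) = (\<integral>e. h e \<partial>E)"
    using int_h by (subst (2) distr_snd[symmetric]) (auto intro!: integral_distr[symmetric])
  note h' = this[unfolded h]
  have "AE r in distr (R \<Otimes>\<^sub>M E) R fst. \<forall>(i, t)\<in>{1..N} \<times> {1..}. r (i, t) = (if i = 1 then \<Delta> else 0)"
    unfolding E.distr_pair_fst by (simp only: R_def AE_reward_space_spike)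
  then have AE_r: "AE x in R \<Otimes>\<^sub>M E. \<forall>(i, t)\<in>{1..N} \<times> {1..}. fst x (i, t) = (if i = 1 then \<Delta> else 0)"
    by (intro AE_distrD[of fst "R \<Otimes>\<^sub>M E" R]) auto
  have "(\<integral>(r, e). (\<Sum>t\<in>{1..T}. r (qcare_action \<alpha> N r e t, t)) \<partial>(R \<Otimes>\<^sub>M E)) \<le> (\<integral>x. h (snd x) \<partial>(R \<Otimes>\<^sub>M E))"
    \<comment> \<open>Measurability of the policy is not needed: a non-integrable left-hand side has the junk value
      \<open>0\<close>, which is also at most the nonnegative right-hand side.\<close>
  proof (rule integral_mono_AE'[OF int_h'])
    show "AE x in R \<Otimes>\<^sub>M E. 0 \<le> h (snd x)"
      using \<open>\<Delta> > 0\<close> by (auto simp: h_def indicator_def intro!: sum_nonneg)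
    show "AE x in R \<Otimes>\<^sub>M E. (case x of (r, e) \<Rightarrow> \<Sum>t\<in>{1..T}. r (qcare_action \<alpha> N r e t, t)) \<le> h (snd x)"
      using AE_r
    proof eventually_elim
      case (elim x)
      obtain r e where x: "x = (r, e)"
        by (cases x)
      have r: "r (i, t) = (if i = 1 then \<Delta> else 0)" if "i \<in> {1..N}" "t \<ge> 1" for i t
        using elim that by (auto simp: x)
      have "r (qcare_action \<alpha> N r e t, t) \<le> \<Delta> * (1 - indicator (bad_noise N t) e)" if "t \<in> {1..T}" for t
      proof -
        have "qcare_action \<alpha> N r e t \<in> {1..N}"
          using is_arg_max_qcare_action[of N \<alpha> r e t] assms by (simp add: is_arg_max_linorder)
        \<comment> \<open>On bad noise an arm other than 1 is played and pays 0; otherwise no arm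
          pays more than \<open>\<Delta>\<close>.\<close>
        moreover have "qcare_action \<alpha> N r e t \<noteq> 1" if "e \<in> bad_noise N t"
          using assms \<open>t \<in> {1..T}\<close> that r
          by (intro qcare_action_neq_1[of _ _ _ T]) (auto simp: bad_noise_def \<Delta>_def)
        ultimately show ?thesis
          using r \<open>\<Delta> > 0\<close> that by (auto simp: indicator_def)
      qed
      then show ?case
        by (auto simp: x h_def intro!: sum_mono)
    qed
  qed
  then have "qcare_regret \<alpha> N (spike_instance \<Delta>) T \<ge> \<Delta> * real T - real T * (\<Delta> * (1 - c))"
    using assms \<open>\<Delta> > 0\<close> unfolding h'
    by (simp add: qcare_regret_def optimal_mean_spike_instance bandit_space_eq R_def E_def)
  also have "\<Delta> * real T - real T * (\<Delta> * (1 - c)) = c * real T powr (1 - \<alpha>)"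
    using assms by (simp add: \<Delta>_def field_simps powr_diff powr_minus_divide)
  finally show ?thesis
    by (simp add: c_def \<Delta>_def)
qed

theorem theorem2:
  fixes \<alpha> :: real and N :: nat
  assumes "0 < \<alpha>" and "\<alpha> < 1 / 2" and "N > 1"
  shows "liminf (\<lambda>T. qcare_worst_case_regret \<alpha> N T / ereal (real T powr (1 - \<alpha>))) > 0"
proof -
  define c where "c = measure std_normal {-2..-1} * measure std_normal {1..2}"
  have "c > 0"
    unfolding c_def by (intro mult_pos_pos measure_std_normal_Icc_pos) auto
  \<comment> \<open>The instance may vary with \<open>T\<close> because the supremum is taken
    separately for each horizon. The condition \<open>T \<ge> 1\<close> makes the divisor
    positive.\<close>
  have "ereal c \<le> qcare_worst_case_regret \<alpha> N T / ereal (real T powr (1 - \<alpha>))" if "T \<ge> 1" for T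
  proof -
    let ?\<Delta> = "real T powr - \<alpha>"
    have "?\<Delta> \<le> 1"
      using that assms by (simp add: powr_le_one_le powr_minus_divide ge_one_powr_ge_zero)
    then have "spike_instance ?\<Delta> \<in> bandit_instances N"
      using that assms by (intro spike_instance_in_bandit_instances) auto
    then have "ereal (qcare_regret \<alpha> N (spike_instance ?\<Delta>) T) \<le> qcare_worst_case_regret \<alpha> N T"
      unfolding qcare_worst_case_regret_def by (rule SUP_upper)
    moreover have "c * real T powr (1 - \<alpha>) \<le> qcare_regret \<alpha> N (spike_instance ?\<Delta>) T"
      unfolding c_def using that assms by (intro qcare_regret_spike_ge) auto
    ultimately have "ereal (c * real T powr (1 - \<alpha>)) \<le> qcare_worst_case_regret \<alpha> N T"
      by (meson ereal_less_eq(3) order_trans)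
    then show ?thesis
      using that by (subst ereal_le_divide_pos) (auto simp: mult.commute)
  qed
  then have "ereal c \<le> liminf (\<lambda>T. qcare_worst_case_regret \<alpha> N T / ereal (real T powr (1 - \<alpha>)))"
    by (intro Liminf_bounded) (auto simp: eventually_sequentially)
  then show ?thesis
    using \<open>c > 0\<close> by (metis ereal_less(2) less_le_trans)
qed

end
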